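(* Let $(M,\omega)$ be a Kähler manifold of complex dimension $n$, $q$ an integer with $1\le q\le n$, and $\phi:M\to\mathbb R$ a smooth function. At a point of $M$, let $\alpha_1\le\alpha_2\le\dots\le\alpha_n$ be the eigenvalues of $dd^c\phi$, and suppose $\sum_{i=1}^q\alpha_i\ge0$ (which holds at every point when $\phi$ is $\omega^q$-plurisubharmonic). Then $\alpha_q,\alpha_{q+1},\dots,\alpha_n$ are non-negative; that is, at most $q-1$ eigenvalues of $dd^c\phi$ are negative.
   Context: Let $dd^c\phi=2\sqrt{-1}\,\partial\bar\partial\phi$. At a point, choose an orthonormal basis $\xi_1,\dots,\xi_n$ of $\Lambda^{1,0}$, with $\omega=\sqrt{-1}\sum\xi_i\wedge\bar\xi_i$, such that $dd^c\phi=\sqrt{-1}\sum_i\alpha_i\xi_i\wedge\bar\xi_i$; the real numbers $\alpha_i$ are the eigenvalues of $dd^c\phi$. A smooth function $\phi$ is $\omega^q$-plurisubharmonic if the sum of any $q$ eigenvalues of $dd^c\phi$ is non-negative at every point (equivalently, the $(q,q)$-form $dd^c\phi\wedge\omega^{q-1}$ is positive). *)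

theory Defs
  imports "HOL-Analysis.Analysis"
begin

section \<open>Smooth and holomorphic maps on open subsets of vector spaces\<close>

(* On open subsets of finite-dimensional spaces this is the usual notion of class C^k. *)
primrec Ck_on :: "nat \<Rightarrow> 'v set \<Rightarrow> ('v::real_normed_vector \<Rightarrow> 'w::real_normed_vector) \<Rightarrow> bool"
where
  "Ck_on 0 S f \<longleftrightarrow> continuous_on S f"
| "Ck_on (Suc k) S f \<longleftrightarrow>
     (\<forall>x\<in>S. f differentiable (at x)) \<and>
     (\<forall>v. Ck_on k S (\<lambda>x. frechet_derivative f (at x) v))"

definition smooth_on :: "'v set \<Rightarrow> ('v::real_normed_vector \<Rightarrow> 'w::real_normed_vector) \<Rightarrow> bool" where
  "smooth_on S f \<longleftrightarrow> (\<forall>k. Ck_on k S f)"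

definition multi_holomorphic_on ::
  "(complex^'n::finite \<Rightarrow> complex^'m::finite) \<Rightarrow> (complex^'n) set \<Rightarrow> bool" where
  "multi_holomorphic_on f S \<longleftrightarrow>
     (\<forall>z\<in>S. \<exists>D. (f has_derivative D) (at z) \<and> Vector_Spaces.linear (*s) (*s) D)"

section \<open>Complex manifolds\<close>

(* A chart is its domain together with its coordinate map; the values of the map off the
   domain are irrelevant. *)
type_synonym ('a, 'n) chart = "'a set \<times> ('a \<Rightarrow> complex^'n)"

abbreviation chart_range :: "('a, 'n::finite) chart \<Rightarrow> (complex^'n) set" where
  "chart_range c \<equiv> snd c ` fst c"

abbreviation chart_inv :: "('a, 'n::finite) chart \<Rightarrow> complex^'n \<Rightarrow> 'a" where
  "chart_inv c \<equiv> inv_into (fst c) (snd c)"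

definition complex_manifold :: "'a topology \<Rightarrow> ('a, 'n::finite) chart set \<Rightarrow> bool" where
  "complex_manifold X A \<longleftrightarrow>
     Hausdorff_space X \<and> second_countable X \<and>
     (\<Union>c\<in>A. fst c) = topspace X \<and>
     (\<forall>c\<in>A. openin X (fst c) \<and> open (chart_range c) \<and>
        homeomorphic_map (subtopology X (fst c)) (top_of_set (chart_range c)) (snd c)) \<and>
     (\<forall>c\<in>A. \<forall>d\<in>A. multi_holomorphic_on (snd d \<circ> chart_inv c) (snd c ` (fst c \<inter> fst d)))"

definition smooth_function :: "('a, 'n::finite) chart set \<Rightarrow> ('a \<Rightarrow> real) \<Rightarrow> bool" where
  "smooth_function A \<phi> \<longleftrightarrow> (\<forall>c\<in>A. smooth_on (chart_range c) (\<phi> \<circ> chart_inv c))"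

definition charts_at :: "('a, 'n::finite) chart set \<Rightarrow> 'a \<Rightarrow> ('a, 'n) chart set" where
  "charts_at A p = {c\<in>A. p \<in> fst c}"

(* Differential at p of the change of coordinates from c to d.  Forms at p are represented by
   their coordinate expressions in all charts around p, related by pullback along these maps. *)
definition transition_deriv ::
  "('a, 'n::finite) chart \<Rightarrow> ('a, 'n) chart \<Rightarrow> 'a \<Rightarrow> complex^'n \<Rightarrow> complex^'n" where
  "transition_deriv c d p = frechet_derivative (snd d \<circ> chart_inv c) (at (snd c p))"

section \<open>Kaehler forms\<close>

(* \<omega> c p u v is the value at the point p of the 2-form on the tangent vectors with coordinates
   u and v in the chart c; the complex structure on tangent vectors is multiplication by \<i>. *)
type_synonym ('a, 'n) two_form =
  "('a, 'n) chart \<Rightarrow> 'a \<Rightarrow> complex^'n \<Rightarrow> complex^'n \<Rightarrow> real"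

definition smooth_two_form :: "('a, 'n::finite) chart set \<Rightarrow> ('a, 'n) two_form \<Rightarrow> bool" where
  "smooth_two_form A \<omega> \<longleftrightarrow>
     (\<forall>c\<in>A. \<forall>p\<in>fst c. bilinear (\<omega> c p) \<and> (\<forall>u v. \<omega> c p u v = - \<omega> c p v u)) \<and>
     (\<forall>p. \<forall>c\<in>charts_at A p. \<forall>d\<in>charts_at A p. \<forall>u v.
        \<omega> c p u v = \<omega> d p (transition_deriv c d p u) (transition_deriv c d p v)) \<and>
     (\<forall>c\<in>A. \<forall>u v. smooth_on (chart_range c) (\<lambda>z. \<omega> c (chart_inv c z) u v))"

(* The exterior derivative evaluated on constant coordinate fields, where brackets vanish. *)
definition closed_two_form :: "('a, 'n::finite) chart set \<Rightarrow> ('a, 'n) two_form \<Rightarrow> bool" where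
  "closed_two_form A \<omega> \<longleftrightarrow>
     (\<forall>c\<in>A. \<forall>z\<in>chart_range c. \<forall>u v w.
        frechet_derivative (\<lambda>y. \<omega> c (chart_inv c y) v w) (at z) u +
        frechet_derivative (\<lambda>y. \<omega> c (chart_inv c y) w u) (at z) v +
        frechet_derivative (\<lambda>y. \<omega> c (chart_inv c y) u v) (at z) w = 0)"

(* The two pointwise conditions say that \<omega> is of type (1,1) and positive. *)
definition Kaehler_form :: "('a, 'n::finite) chart set \<Rightarrow> ('a, 'n) two_form \<Rightarrow> bool" where
  "Kaehler_form A \<omega> \<longleftrightarrow>
     smooth_two_form A \<omega> \<and> closed_two_form A \<omega> \<and>
     (\<forall>c\<in>A. \<forall>p\<in>fst c.
        (\<forall>u v. \<omega> c p (\<i> *s u) (\<i> *s v) = \<omega> c p u v) \<and>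
        (\<forall>v. v \<noteq> 0 \<longrightarrow> \<omega> c p v (\<i> *s v) > 0))"

definition Kaehler_manifold ::
  "'a topology \<Rightarrow> ('a, 'n::finite) chart set \<Rightarrow> ('a, 'n) two_form \<Rightarrow> bool" where
  "Kaehler_manifold X A \<omega> \<longleftrightarrow> complex_manifold X A \<and> Kaehler_form A \<omega>"

section \<open>The form $dd^c\phi$\<close>

definition wirtinger :: "'n::finite \<Rightarrow> (complex^'n \<Rightarrow> complex) \<Rightarrow> complex^'n \<Rightarrow> complex" where
  "wirtinger j f z =
     (frechet_derivative f (at z) (axis j 1) - \<i> * frechet_derivative f (at z) (axis j \<i>)) / 2"

definition wirtinger_bar :: "'n::finite \<Rightarrow> (complex^'n \<Rightarrow> complex) \<Rightarrow> complex^'n \<Rightarrow> complex" where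
  "wirtinger_bar j f z =
     (frechet_derivative f (at z) (axis j 1) + \<i> * frechet_derivative f (at z) (axis j \<i>)) / 2"

definition wedge :: "('v \<Rightarrow> complex) \<Rightarrow> ('v \<Rightarrow> complex) \<Rightarrow> 'v \<Rightarrow> 'v \<Rightarrow> complex" where
  "wedge \<xi> \<eta> u v = \<xi> u * \<eta> v - \<xi> v * \<eta> u"

definition ddc ::
  "('a \<Rightarrow> real) \<Rightarrow> ('a, 'n::finite) chart \<Rightarrow> 'a \<Rightarrow> complex^'n \<Rightarrow> complex^'n \<Rightarrow> complex" where
  "ddc \<phi> c p u v =
     2 * \<i> * (\<Sum>j\<in>UNIV. \<Sum>k\<in>UNIV.
       wirtinger j (wirtinger_bar k (\<lambda>z. complex_of_real (\<phi> (chart_inv c z)))) (snd c p) *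
       wedge (\<lambda>w. w $ j) (\<lambda>w. cnj (w $ k)) u v)"

section \<open>Eigenvalues of $dd^c\phi$\<close>

(* The fibre at p of the bundle of (1,0)-forms; covectors are set to 0 in charts not
   containing p, so that they are determined by their actual coordinate expressions. *)
definition Lambda10 ::
  "('a, 'n::finite) chart set \<Rightarrow> 'a \<Rightarrow> (('a, 'n) chart \<Rightarrow> complex^'n \<Rightarrow> complex) set" where
  "Lambda10 A p =
     {\<xi>. (\<forall>c\<in>charts_at A p. Vector_Spaces.linear (*s) (*) (\<xi> c)) \<and>
         (\<forall>c\<in>charts_at A p. \<forall>d\<in>charts_at A p. \<forall>v. \<xi> c v = \<xi> d (transition_deriv c d p v)) \<and>
         (\<forall>c. c \<notin> charts_at A p \<longrightarrow> \<xi> c = (\<lambda>v. 0))}"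

definition basis_Lambda10 ::
  "('a, 'n::finite) chart set \<Rightarrow> 'a \<Rightarrow> (nat \<Rightarrow> ('a, 'n) chart \<Rightarrow> complex^'n \<Rightarrow> complex) \<Rightarrow> bool" where
  "basis_Lambda10 A p \<xi> \<longleftrightarrow>
     (\<forall>i\<in>{1..CARD('n)}. \<xi> i \<in> Lambda10 A p) \<and>
     (\<forall>a. (\<forall>c v. (\<Sum>i=1..CARD('n). a i * \<xi> i c v) = 0) \<longrightarrow> (\<forall>i\<in>{1..CARD('n)}. a i = 0)) \<and>
     (\<forall>\<eta>\<in>Lambda10 A p. \<exists>a. \<forall>c v. \<eta> c v = (\<Sum>i=1..CARD('n). a i * \<xi> i c v))"

(* Orthonormality of the basis is the identity for \<omega>, which fixes the normalization of the
   Hermitian metric on (1,0)-forms. *)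
definition orthonormal_coframe ::
  "('a, 'n::finite) chart set \<Rightarrow> ('a, 'n) two_form \<Rightarrow> 'a \<Rightarrow>
   (nat \<Rightarrow> ('a, 'n) chart \<Rightarrow> complex^'n \<Rightarrow> complex) \<Rightarrow> bool" where
  "orthonormal_coframe A \<omega> p \<xi> \<longleftrightarrow>
     basis_Lambda10 A p \<xi> \<and>
     (\<forall>c\<in>charts_at A p. \<forall>u v.
        complex_of_real (\<omega> c p u v) =
        \<i> * (\<Sum>i=1..CARD('n). wedge (\<xi> i c) (cnj \<circ> \<xi> i c) u v))"

(* \<alpha> 1, ..., \<alpha> n lists the eigenvalues with multiplicity, in no prescribed order. *)
definition ddc_eigenvalues ::
  "('a, 'n::finite) chart set \<Rightarrow> ('a, 'n) two_form \<Rightarrow> ('a \<Rightarrow> real) \<Rightarrow> 'a \<Rightarrow> (nat \<Rightarrow> real) \<Rightarrow> bool" where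
  "ddc_eigenvalues A \<omega> \<phi> p \<alpha> \<longleftrightarrow>
     (\<exists>\<xi>. orthonormal_coframe A \<omega> p \<xi> \<and>
        (\<forall>c\<in>charts_at A p. \<forall>u v.
           ddc \<phi> c p u v =
           \<i> * (\<Sum>i=1..CARD('n). complex_of_real (\<alpha> i) * wedge (\<xi> i c) (cnj \<circ> \<xi> i c) u v)))"

definition omega_psh ::
  "'a topology \<Rightarrow> ('a, 'n::finite) chart set \<Rightarrow> ('a, 'n) two_form \<Rightarrow> nat \<Rightarrow> ('a \<Rightarrow> real) \<Rightarrow> bool" where
  "omega_psh X A \<omega> q \<phi> \<longleftrightarrow>
     smooth_function A \<phi> \<and>
     (\<forall>p\<in>topspace X. \<forall>\<alpha>. ddc_eigenvalues A \<omega> \<phi> p \<alpha> \<longrightarrow>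
        (\<forall>J. J \<subseteq> {1..CARD('n)} \<and> card J = q \<longrightarrow> (\<Sum>i\<in>J. \<alpha> i) \<ge> 0))"

end

theory Submission
  imports Defs
begin

text \<open>
  For eigenvalues in increasing order, \<open>\<alpha> q\<close> is at least the average of \<open>\<alpha> 1, \<dots>, \<alpha> q\<close>, which is
  non-negative by hypothesis; so \<open>\<alpha> q\<close> and everything after it is non-negative
  (\<open>mono_partial_sum_nonneg\<close>), and a negative eigenvalue can only sit among the first
  \<open>q - 1\<close> positions (\<open>card_negative_le\<close>).  When \<open>\<phi>\<close> is \<open>\<omega>\<^sup>q\<close>-plurisubharmonic, the first \<open>q\<close>
  eigenvalues are a particular choice of \<open>q\<close> eigenvalues, so their sum is non-negative.
  Geometry enters only in producing the eigenvalues; the argument at each point is about finite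
  sequences of reals.
\<close>

text \<open>Every term of the partial sum is bounded above by \<open>\<alpha> q\<close>, hence the sum is bounded above by \<open>q \<alpha> q\<close>.\<close>

lemma mono_partial_sum_nonneg:
  fixes \<alpha> :: "nat \<Rightarrow> real"
  assumes mono: "mono_on {1..n} \<alpha>" and q: "1 \<le> q" and sum: "(\<Sum>i=1..q. \<alpha> i) \<ge> 0"
    and i: "i \<in> {q..n}"
  shows "\<alpha> i \<ge> 0"
proof -
  have "\<alpha> j \<le> \<alpha> q" if "j \<in> {1..q}" for j
    using mono by (rule mono_onD) (use that q i in auto)
  then have "(\<Sum>j=1..q. \<alpha> j) \<le> real q * \<alpha> q"
    using sum_bounded_above[of "{1..q}" \<alpha> "\<alpha> q"] by simp
  with sum have "0 \<le> real q * \<alpha> q"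
    by linarith
  then have "0 \<le> \<alpha> q"
    using q by (simp add: zero_le_mult_iff)
  also have "\<alpha> q \<le> \<alpha> i"
    using mono by (rule mono_onD) (use q i in auto)
  finally show ?thesis .
qed

lemma card_negative_le:
  fixes \<alpha> :: "nat \<Rightarrow> real"
  assumes "\<forall>i\<in>{q..n}. \<alpha> i \<ge> 0"
  shows "card {i\<in>{1..n}. \<alpha> i < 0} \<le> q - 1"
proof -
  have "{i\<in>{1..n}. \<alpha> i < 0} \<subseteq> {1..<q}"
    using assms by (fastforce simp: not_less[symmetric])
  then show ?thesis
    using card_mono[of "{1..<q}"] by fastforce
qed

theorem mainTheorem8:
  fixes X :: "'a topology" and A :: "('a, 'n::finite) chart set" and \<omega> :: "('a, 'n) two_form"
    and \<phi> :: "'a \<Rightarrow> real" and q :: nat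
  assumes "Kaehler_manifold X A \<omega>"
    and "1 \<le> q" and "q \<le> CARD('n)"
    and "smooth_function A \<phi>"
  shows "(\<forall>p\<in>topspace X. \<forall>\<alpha>.
            ddc_eigenvalues A \<omega> \<phi> p \<alpha> \<and> mono_on {1..CARD('n)} \<alpha> \<and> (\<Sum>i=1..q. \<alpha> i) \<ge> 0 \<longrightarrow>
            (\<forall>i\<in>{q..CARD('n)}. \<alpha> i \<ge> 0) \<and> card {i\<in>{1..CARD('n)}. \<alpha> i < 0} \<le> q - 1) \<and>
         (omega_psh X A \<omega> q \<phi> \<longrightarrow>
          (\<forall>p\<in>topspace X. \<forall>\<alpha>.
            ddc_eigenvalues A \<omega> \<phi> p \<alpha> \<and> mono_on {1..CARD('n)} \<alpha> \<longrightarrow> (\<Sum>i=1..q. \<alpha> i) \<ge> 0))"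
proof (intro conjI impI ballI allI; (elim conjE)?)
  fix p i and \<alpha> :: "nat \<Rightarrow> real"
  assume "mono_on {1..CARD('n)} \<alpha>" "(\<Sum>i=1..q. \<alpha> i) \<ge> 0" "i \<in> {q..CARD('n)}"
  then show "\<alpha> i \<ge> 0"
    using mono_partial_sum_nonneg assms(2) by blast
next
  fix p and \<alpha> :: "nat \<Rightarrow> real"
  assume "mono_on {1..CARD('n)} \<alpha>" "(\<Sum>i=1..q. \<alpha> i) \<ge> 0"
  then show "card {i\<in>{1..CARD('n)}. \<alpha> i < 0} \<le> q - 1"
    using mono_partial_sum_nonneg assms(2) by (blast intro: card_negative_le)
next
  fix p and \<alpha> :: "nat \<Rightarrow> real"
  assume "omega_psh X A \<omega> q \<phi>" "p \<in> topspace X" "ddc_eigenvalues A \<omega> \<phi> p \<alpha>"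
  moreover have "{1..q} \<subseteq> {1..CARD('n)}" "card {1..q} = q"
    using assms(3) by auto
  ultimately show "(\<Sum>i=1..q. \<alpha> i) \<ge> 0"
    unfolding omega_psh_def by blast
qed

end
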